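(* Let $\rho=\mathrm{Ind}_{\bar\Gamma_0(2)}^{\Gamma}\chi$ be the representation of $\Gamma=\mathrm{PSL}_2(\mathbf{Z})$ induced from a one-dimensional representation $\chi$ of $\bar\Gamma_0(2)$ with finite image, and let $n$ be such that $\chi(\bar U)$ is a primitive $n$-th root of unity. Then $\ker\rho$ is a congruence subgroup of $\Gamma$ if and only if $n\mid 24$.
   Context: $\bar M$ denotes the image in $\mathrm{PSL}_2(\mathbf{Z})$ of a matrix or subgroup $M$ of $\mathrm{SL}_2(\mathbf{Z})$; $\bar\Gamma_0(2)$ is the image of $\Gamma_0(2)$, and $U=\begin{pmatrix}1&0\\2&1\end{pmatrix}$. A subgroup of $\Gamma$ is congruence if it contains $\bar\Gamma(N)$ for some $N\ge1$. *)

theory Defs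
  imports "HOL-Analysis.Analysis" "HOL-Algebra.Bij" "HOL-Algebra.Coset" "HOL-Number_Theory.Cong"
begin

type_synonym mat2 = "int ^ 2 ^ 2"

definition SL2Z :: "mat2 monoid" where
  "SL2Z = \<lparr>carrier = {A. det A = 1}, monoid.mult = (**), one = mat 1\<rparr>"

definition PSL2Z :: "mat2 set monoid" where
  "PSL2Z = SL2Z Mod {mat 1, - mat 1}"

text \<open>The class of a matrix in the projective group is the set consisting of the matrix and its negative.\<close>

definition pbar :: "mat2 \<Rightarrow> mat2 set" where
  "pbar A = {mat 1, - mat 1} #>\<^bsub>SL2Z\<^esub> A"

definition Gamma0 :: "nat \<Rightarrow> mat2 set" where
  "Gamma0 N = {A \<in> carrier SL2Z. int N dvd A $ 2 $ 1}"

definition PGamma0 :: "nat \<Rightarrow> mat2 set set" where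
  "PGamma0 N = pbar ` Gamma0 N"

definition Gamma_princ :: "nat \<Rightarrow> mat2 set" where
  "Gamma_princ N = {A \<in> carrier SL2Z. \<forall>i j. [A $ i $ j = (mat 1 :: mat2) $ i $ j] (mod int N)}"

definition U_mat :: mat2 where
  "U_mat = vector [vector [1, 0], vector [2, 1]]"

definition congruence_subgroup :: "mat2 set set \<Rightarrow> bool" where
  "congruence_subgroup K \<longleftrightarrow> subgroup K PSL2Z \<and> (\<exists>N\<ge>1. pbar ` Gamma_princ N \<subseteq> K)"

definition primitive_root_of_unity :: "nat \<Rightarrow> complex \<Rightarrow> bool" where
  "primitive_root_of_unity n z \<longleftrightarrow> n \<ge> 1 \<and> z ^ n = 1 \<and> (\<forall>k. 1 \<le> k \<and> k < n \<longrightarrow> z ^ k \<noteq> 1)"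

definition complex_units :: "complex monoid" where
  "complex_units = \<lparr>carrier = UNIV - {0}, monoid.mult = (*), one = 1\<rparr>"

text \<open>A one-dimensional representation of the subgroup \<open>H\<close> of \<open>G\<close>; the values outside \<open>H\<close> are irrelevant.\<close>

definition one_dim_rep :: "('g, 'm) monoid_scheme \<Rightarrow> 'g set \<Rightarrow> ('g \<Rightarrow> complex) \<Rightarrow> bool" where
  "one_dim_rep G H \<psi> \<longleftrightarrow> \<psi> \<in> hom (G\<lparr>carrier := H\<rparr>) complex_units"

text \<open>The general linear group of a complex vector space \<open>V\<close> of functions, with
  pointwise operations. As in \<^const>\<open>BijGroup\<close>, its elements are extensional on \<open>V\<close>.\<close>

definition GL :: "('g \<Rightarrow> complex) set \<Rightarrow> (('g \<Rightarrow> complex) \<Rightarrow> ('g \<Rightarrow> complex)) monoid" where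
  "GL V = (BijGroup V)\<lparr>carrier := {T \<in> Bij V.
      (\<forall>f\<in>V. \<forall>g\<in>V. T (\<lambda>x. f x + g x) = (\<lambda>x. T f x + T g x)) \<and>
      (\<forall>c. \<forall>f\<in>V. T (\<lambda>x. c * f x) = (\<lambda>x. c * T f x))}\<rparr>"

text \<open>The representation of \<open>G\<close> induced from \<open>\<psi>\<close>: \<open>G\<close> acts by right translation on
  the functions \<open>f\<close> on \<open>G\<close> that satisfy \<open>f (h x) = \<psi> h \<cdot> f x\<close> for \<open>h\<close> in \<open>H\<close>.
  Functions on \<open>G\<close> are encoded as functions on the ambient type vanishing off the carrier.\<close>

definition ind_space :: "('g, 'm) monoid_scheme \<Rightarrow> 'g set \<Rightarrow> ('g \<Rightarrow> complex) \<Rightarrow> ('g \<Rightarrow> complex) set" where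
  "ind_space G H \<psi> = {f. (\<forall>x. x \<notin> carrier G \<longrightarrow> f x = 0) \<and>
      (\<forall>h\<in>H. \<forall>x\<in>carrier G. f (h \<otimes>\<^bsub>G\<^esub> x) = \<psi> h * f x)}"

definition ind_rep ::
  "('g, 'm) monoid_scheme \<Rightarrow> 'g set \<Rightarrow> ('g \<Rightarrow> complex) \<Rightarrow> 'g \<Rightarrow> ('g \<Rightarrow> complex) \<Rightarrow> ('g \<Rightarrow> complex)" where
  "ind_rep G H \<psi> g = (\<lambda>f \<in> ind_space G H \<psi>. \<lambda>x. if x \<in> carrier G then f (x \<otimes>\<^bsub>G\<^esub> g) else 0)"

lemma SL2Z_simps [simp]:
  "carrier SL2Z = {A. det A = 1}" "A \<otimes>\<^bsub>SL2Z\<^esub> B = A ** B" "\<one>\<^bsub>SL2Z\<^esub> = mat 1"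
  by (simp_all add: SL2Z_def)

lemma mat2_neg_one_mult:
  fixes A :: mat2 shows "- mat 1 ** A = - A" "A ** - mat 1 = - A"
  by (simp_all add: vec_eq_iff matrix_matrix_mult_def mat_def sum_2 forall_2)

lemma det_uminus_mat2: "det (- A :: mat2) = det A"
  by (simp add: det_2)

lemma pbar_eq: "pbar A = {A, - A}"
  by (auto simp: pbar_def r_coset_def mat2_neg_one_mult)

lemma group_SL2Z: "group SL2Z"
proof (rule groupI)
  fix A assume A: "A \<in> carrier SL2Z"
  define B :: mat2 where "B = vector [vector [A$2$2, - (A$1$2)], vector [- (A$2$1), A$1$1]]"
  have "det B = 1" using A by (simp add: B_def det_2 mult.commute)
  moreover have "B ** A = mat 1" using A
    by (simp add: B_def vec_eq_iff matrix_matrix_mult_def mat_def sum_2 forall_2 det_2 algebra_simps)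
  ultimately show "\<exists>B\<in>carrier SL2Z. B \<otimes>\<^bsub>SL2Z\<^esub> A = \<one>\<^bsub>SL2Z\<^esub>" by auto
qed (auto simp: det_mul matrix_mul_assoc det_I)

lemma normal_center: "{mat 1, - mat 1} \<lhd> SL2Z"
proof -
  interpret group SL2Z by (rule group_SL2Z)
  have inv: "inv\<^bsub>SL2Z\<^esub> (- mat 1 :: mat2) = - mat 1"
    by (rule inv_equality) (auto simp: mat2_neg_one_mult det_uminus_mat2)
  have "subgroup {mat 1, - mat 1} SL2Z"
    by (rule subgroupI) (use inv in \<open>auto simp: mat2_neg_one_mult det_uminus_mat2 inv_one[simplified]\<close>)
  then show ?thesis
    by (rule normalI) (auto simp: r_coset_def l_coset_def mat2_neg_one_mult)
qed

lemma group_PSL2Z: "group PSL2Z"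
  unfolding PSL2Z_def by (rule normal.factorgroup_is_group[OF normal_center])

lemma pbar_hom: "pbar \<in> hom SL2Z PSL2Z"
  using normal.r_coset_hom_Mod[OF normal_center] by (simp add: pbar_def[abs_def] PSL2Z_def)

lemma subgroup_Gamma0: "subgroup (Gamma0 N) SL2Z"
proof -
  interpret group SL2Z by (rule group_SL2Z)
  show ?thesis
  proof (rule subgroupI)
    fix A assume A: "A \<in> Gamma0 N"
    define B :: mat2 where "B = vector [vector [A$2$2, - (A$1$2)], vector [- (A$2$1), A$1$1]]"
    have "det A = 1" using A by (simp add: Gamma0_def)
    moreover from this have "det B = 1" by (simp add: B_def det_2 mult.commute)
    moreover have "B ** A = mat 1" using \<open>det A = 1\<close>
      by (simp add: B_def vec_eq_iff matrix_matrix_mult_def mat_def sum_2 forall_2 det_2 algebra_simps)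
    ultimately have "inv\<^bsub>SL2Z\<^esub> A = B" by (intro inv_equality) auto
    with A \<open>det B = 1\<close> show "inv\<^bsub>SL2Z\<^esub> A \<in> Gamma0 N"
      by (simp add: Gamma0_def B_def)
  next
    have "mat 1 \<in> Gamma0 N" by (simp add: Gamma0_def mat_def det_2)
    then show "Gamma0 N \<noteq> {}" by blast
  next
    fix A B assume "A \<in> Gamma0 N" "B \<in> Gamma0 N"
    moreover have "(A ** B) $ 2 $ 1 = A$2$1 * B$1$1 + A$2$2 * B$2$1"
      by (simp add: matrix_matrix_mult_def sum_2)
    ultimately show "A \<otimes>\<^bsub>SL2Z\<^esub> B \<in> Gamma0 N"
      by (simp add: Gamma0_def det_mul)
  qed (auto simp: Gamma0_def)
qed

lemma subgroup_PGamma0: "subgroup (PGamma0 N) PSL2Z"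
proof -
  interpret group_hom SL2Z PSL2Z pbar
    using group_SL2Z group_PSL2Z pbar_hom by (simp add: group_hom_def group_hom_axioms_def)
  show ?thesis unfolding PGamma0_def by (rule subgroup_img_is_subgroup[OF subgroup_Gamma0])
qed

lemma U_mat_in_Gamma0: "U_mat \<in> Gamma0 2"
  by (simp add: Gamma0_def U_mat_def det_2)

lemma ind_rep_hom:
  assumes "group G" "subgroup H G"
  shows "ind_rep G H \<psi> \<in> hom G (GL (ind_space G H \<psi>))"
proof -
  interpret group G by fact
  interpret H: subgroup H G by fact
  let ?V = "ind_space G H \<psi>"
  have maps: "ind_rep G H \<psi> g f \<in> ?V" if "g \<in> carrier G" "f \<in> ?V" for g f
    using that by (auto simp: ind_rep_def ind_space_def m_assoc)
  have comp: "ind_rep G H \<psi> a (ind_rep G H \<psi> b f) = ind_rep G H \<psi> (a \<otimes>\<^bsub>G\<^esub> b) f"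
    if "a \<in> carrier G" "b \<in> carrier G" "f \<in> ?V" for a b f
    using that maps[of b f] by (auto simp: ind_rep_def m_assoc fun_eq_iff)
  have one: "ind_rep G H \<psi> \<one>\<^bsub>G\<^esub> f = f" if "f \<in> ?V" for f
    using that by (auto simp: ind_rep_def fun_eq_iff ind_space_def)
  have bij: "ind_rep G H \<psi> g \<in> Bij ?V" if g: "g \<in> carrier G" for g
  proof -
    have "bij_betw (ind_rep G H \<psi> g) ?V ?V"
      by (rule bij_betw_byWitness[where f' = "ind_rep G H \<psi> (inv\<^bsub>G\<^esub> g)"])
         (use g maps comp one in auto)
    then show ?thesis by (simp add: Bij_def ind_rep_def)
  qed
  have add: "(\<lambda>x. f x + f' x) \<in> ?V" if "f \<in> ?V" "f' \<in> ?V" for f f'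
    using that by (simp add: ind_space_def distrib_left)
  have scale: "(\<lambda>x. c * f x) \<in> ?V" if "f \<in> ?V" for f c
    using that by (simp add: ind_space_def)
  show ?thesis
  proof (rule homI)
    fix g assume "g \<in> carrier G"
    with bij show "ind_rep G H \<psi> g \<in> carrier (GL ?V)"
      by (auto simp: GL_def add scale ind_rep_def)
  next
    fix a b assume "a \<in> carrier G" "b \<in> carrier G"
    with bij comp show "ind_rep G H \<psi> (a \<otimes>\<^bsub>G\<^esub> b) =
        ind_rep G H \<psi> a \<otimes>\<^bsub>GL ?V\<^esub> ind_rep G H \<psi> b"
      by (auto simp: GL_def BijGroup_def compose_def fun_eq_iff) (auto simp: ind_rep_def)
  qed
qed

end

theory Submission
  imports Defs
begin

text \<open>The kernel of the induced representation is the normal core of the kernel of the character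
  \<open>\<psi>\<close>, so it is a congruence subgroup iff \<open>\<psi>\<close> is trivial on some \<open>\<Gamma>(N)\<close>.

  If \<open>\<psi>\<close> is trivial on \<open>\<Gamma>(N)\<close>, conjugating \<open>U\<close> by a matrix congruent to \<open>diag(v\<^sup>-\<^sup>1, v)\<close>
  modulo \<open>N\<close> gives \<open>\<psi>(U) = \<psi>(U)\<^bsup>v\<^sup>2\<^esup>\<close>, so \<open>n\<close> divides \<open>v\<^sup>2 - 1\<close> for all \<open>v\<close> prime to \<open>N\<close>,
  which forces \<open>n\<close> to divide \<open>24\<close>.

  Conversely, the multiplier system of the eta quotient \<open>\<eta>(2\<tau>)/\<eta>(\<tau>)\<close> is a character of
  \<open>\<Gamma>\<^sub>0(2)\<close> with values in the 24-th roots of unity which depends only on the entries modulo \<open>48\<close>.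
  If \<open>n\<close> divides \<open>24\<close>, then \<open>\<psi>\<close> agrees with a power of it on \<open>T\<close> and \<open>U\<close>, up to the
  character \<open>A \<mapsto> (-1)\<^sup>b\<close>; as \<open>T\<close>, \<open>U\<close> and \<open>-1\<close> generate \<open>\<Gamma>\<^sub>0(2)\<close>, it is trivial on \<open>\<Gamma>(48)\<close>.\<close>

section \<open>Matrices given by their entries\<close>

definition mk2 :: "int \<Rightarrow> int \<Rightarrow> int \<Rightarrow> int \<Rightarrow> mat2" where
  "mk2 a b c d = vector [vector [a, b], vector [c, d]]"

lemma mk2_nth [simp]:
  "mk2 a b c d $ 1 $ 1 = a" "mk2 a b c d $ 1 $ 2 = b"
  "mk2 a b c d $ 2 $ 1 = c" "mk2 a b c d $ 2 $ 2 = d"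
  by (simp_all add: mk2_def)

lemma mk2_eta: "mk2 (A $ 1 $ 1) (A $ 1 $ 2) (A $ 2 $ 1) (A $ 2 $ 2) = A"
  by (simp add: vec_eq_iff forall_2)

lemma mk2_eq_iff [simp]:
  "mk2 a b c d = mk2 a' b' c' d' \<longleftrightarrow> a = a' \<and> b = b' \<and> c = c' \<and> d = d'"
  by (auto simp: vec_eq_iff forall_2)

lemma det_mk2 [simp]: "det (mk2 a b c d) = a * d - b * c"
  by (simp add: det_2)

lemma mk2_mult [simp]:
  "mk2 a b c d ** mk2 a' b' c' d' =
    mk2 (a * a' + b * c') (a * b' + b * d') (c * a' + d * c') (c * b' + d * d')"
  by (simp add: vec_eq_iff forall_2 matrix_matrix_mult_def sum_2)

lemma mk2_uminus [simp]: "- mk2 a b c d = mk2 (- a) (- b) (- c) (- d)"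
  by (simp add: vec_eq_iff forall_2)

lemma mat_1_eq_mk2: "(mat 1 :: mat2) = mk2 1 0 0 1"
  by (simp add: vec_eq_iff forall_2 mat_def)

lemma U_mat_eq_mk2: "U_mat = mk2 1 0 2 1"
  by (simp add: U_mat_def mk2_def)

lemma mk2_in_Gamma0_iff [simp]:
  "mk2 a b c d \<in> Gamma0 N \<longleftrightarrow> a * d - b * c = 1 \<and> int N dvd c"
  by (simp add: Gamma0_def)

lemma mk2_in_Gamma_princ_iff [simp]:
  "mk2 a b c d \<in> Gamma_princ N \<longleftrightarrow>
    a * d - b * c = 1 \<and> int N dvd a - 1 \<and> int N dvd b \<and> int N dvd c \<and> int N dvd d - 1"
  by (auto simp: Gamma_princ_def forall_2 mat_def cong_iff_dvd_diff)

lemma Gamma_princ_subset_Gamma0: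
  assumes "M dvd N"
  shows "Gamma_princ N \<subseteq> Gamma0 M"
proof
  fix A assume A: "A \<in> Gamma_princ N"
  obtain a b c d where "A = mk2 a b c d" by (metis mk2_eta)
  moreover have "int M dvd int N" using assms by simp
  ultimately show "A \<in> Gamma0 M" using A by (auto intro: dvd_trans)
qed

lemma Gamma_princ_mono: "M dvd N \<Longrightarrow> Gamma_princ N \<subseteq> Gamma_princ M"
proof
  fix A assume "M dvd N" and A: "A \<in> Gamma_princ N"
  then have "int M dvd int N" by simp
  then show "A \<in> Gamma_princ M"
    using A unfolding Gamma_princ_def cong_iff_dvd_diff by (blast intro: dvd_trans)
qed

section \<open>The projection to the projective group and normality of
  \<open>Gamma_princ\<close>\<close>

interpretation SL2: group SL2Z
  by (rule group_SL2Z)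

interpretation PSL2: group PSL2Z
  by (rule group_PSL2Z)

interpretation pbar: group_hom SL2Z PSL2Z pbar
  by (simp add: group_hom_def group_hom_axioms_def group_SL2Z group_PSL2Z pbar_hom)

lemma pbar_uminus: "pbar (- A) = pbar A"
  by (auto simp: pbar_eq)

lemma pbar_surj: "x \<in> carrier PSL2Z \<Longrightarrow> \<exists>X. det X = 1 \<and> x = pbar X"
  unfolding PSL2Z_def FactGroup_def RCOSETS_def by (auto simp: pbar_def)

lemma inv_mk2: "a * d - b * c = 1 \<Longrightarrow> inv\<^bsub>SL2Z\<^esub> (mk2 a b c d) = mk2 d (- b) (- c) a"
  by (rule SL2.inv_equality) (auto simp: mat_1_eq_mk2 algebra_simps)

text \<open>With A = 1 + N A', each entry of X A X^-1 - 1 is a multiple of N plus a multiple of det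
  X - 1, which vanishes.\<close>

lemma Gamma_princ_conj:
  assumes "A \<in> Gamma_princ N" "det X = 1"
  shows "X ** A ** inv\<^bsub>SL2Z\<^esub> X \<in> Gamma_princ N"
proof -
  obtain a b c d where A: "A = mk2 a b c d" by (metis mk2_eta)
  obtain p q r s where X: "X = mk2 p q r s" by (metis mk2_eta)
  have det: "p * s - q * r = 1" "a * d - b * c = 1"
    using assms by (simp_all add: X A)
  have "int N dvd a - 1" "int N dvd b" "int N dvd c" "int N dvd d - 1"
    using assms(1) by (simp_all add: A)
  then obtain a' b' c' d'
    where "a - 1 = int N * a'" "b = int N * b'" "c = int N * c'" "d - 1 = int N * d'"
    by (elim dvdE)
  then have abcd: "a = 1 + int N * a'" "b = int N * b'" "c = int N * c'" "d = 1 + int N * d'"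
    by simp_all
  have conj: "X ** A ** inv\<^bsub>SL2Z\<^esub> X =
      mk2 ((p * a + q * c) * s - (p * b + q * d) * r) ((p * b + q * d) * p - (p * a + q * c) * q)
        ((r * a + s * c) * s - (r * b + s * d) * r) ((r * b + s * d) * p - (r * a + s * c) * q)"
    unfolding X A inv_mk2[OF det(1)] mk2_mult mk2_eq_iff by (simp add: mult_ac)
  have "det (X ** A ** inv\<^bsub>SL2Z\<^esub> X) = det X * det A * det (inv\<^bsub>SL2Z\<^esub> X)"
    by (simp only: det_mul)
  also have "\<dots> = 1"
    using det unfolding X A inv_mk2[OF det(1)] det_mk2 by (simp add: mult.commute)
  finally have "det (X ** A ** inv\<^bsub>SL2Z\<^esub> X) = 1" .
  moreover have "(p * a + q * c) * s - (p * b + q * d) * r - 1 =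
      (p * s - q * r - 1) + int N * (p * s * a' + q * s * c' - p * r * b' - q * r * d')"
    "(p * b + q * d) * p - (p * a + q * c) * q =
      int N * (- p * q * a' - q * q * c' + p * p * b' + p * q * d')"
    "(r * a + s * c) * s - (r * b + s * d) * r =
      int N * (r * s * a' + s * s * c' - r * r * b' - r * s * d')"
    "(r * b + s * d) * p - (r * a + s * c) * q - 1 =
      (p * s - q * r - 1) + int N * (- r * q * a' - q * s * c' + r * p * b' + s * p * d')"
    unfolding abcd by (simp_all add: algebra_simps)
  ultimately show ?thesis
    unfolding conj mk2_in_Gamma_princ_iff det_mk2 using det(1) by (metis diff_self add_0 dvd_triv_left)
qed

section \<open>Generators of \<open>\<Gamma>\<^sub>0(2)\<close>\<close>

definition T_mat :: mat2 where
  "T_mat = mk2 1 1 0 1"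

lemma T_mat_in_Gamma0: "T_mat \<in> Gamma0 N"
  by (simp add: T_mat_def)

text \<open>\<open>T\<close> is an equivalence, so the induction can run from 0 both upwards and
  downwards.\<close>

lemma upper_triangular_induct:
  assumes one: "P (mk2 1 0 0 1)"
    and T: "\<And>A. A \<in> Gamma0 2 \<Longrightarrow> P (A ** T_mat) \<longleftrightarrow> P A"
  shows "P (mk2 1 b 0 1)"
proof (induction b rule: int_induct[where k = 0])
  case (step1 i)
  then show ?case using T[of "mk2 1 i 0 1"] by (simp add: T_mat_def add.commute)
next
  case (step2 i)
  then show ?case using T[of "mk2 1 (i - 1) 0 1"] by (simp add: T_mat_def)
qed (rule one)

text \<open>Euclid's algorithm on the bottom row \<open>(c, d)\<close>; as \<open>c\<close> is even and \<open>d\<close> is odd,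
  the reduction can only stop at \<open>c = 0\<close>.\<close>

lemma Gamma0_2_induct [consumes 1, case_names one neg T U]:
  assumes "A \<in> Gamma0 2"
    and one: "P (mat 1)"
    and neg: "\<And>A. A \<in> Gamma0 2 \<Longrightarrow> P A \<Longrightarrow> P (- A)"
    and T: "\<And>A. A \<in> Gamma0 2 \<Longrightarrow> P (A ** T_mat) \<longleftrightarrow> P A"
    and U: "\<And>A. A \<in> Gamma0 2 \<Longrightarrow> P (A ** U_mat) \<longleftrightarrow> P A"
  shows "P A"
proof -
  have "P (mk2 a b c d)" if "a * d - b * c = 1" "even c" for a b c d
    using that
  proof (induction "nat (\<bar>c\<bar> + \<bar>d\<bar>)" arbitrary: a b c d rule: less_induct)
    case less
    \<comment> \<open>The four moves are right multiplication by the inverse of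
      \<open>T_mat\<close>, by \<open>T_mat\<close>, by the inverse of \<open>U_mat\<close> and by
      \<open>U_mat\<close>. They subtract or add \<open>c\<close> in \<open>d\<close>, or
      \<open>2 * d\<close> in \<open>c\<close>.\<close>
    have Tm: "P (mk2 a b c d) \<longleftrightarrow> P (mk2 a (b - a) c (d - c))"
      using T[of "mk2 a (b - a) c (d - c)"] less.prems
      by (simp add: T_mat_def algebra_simps)
    have Tp: "P (mk2 a (a + b) c (c + d)) \<longleftrightarrow> P (mk2 a b c d)"
      using T[of "mk2 a b c d"] less.prems by (simp add: T_mat_def)
    have Um: "P (mk2 a b c d) \<longleftrightarrow> P (mk2 (a - 2 * b) b (c - 2 * d) d)"
      using U[of "mk2 (a - 2 * b) b (c - 2 * d) d"] less.prems
      by (simp add: U_mat_eq_mk2 algebra_simps)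
    have Up: "P (mk2 (a + b * 2) b (c + d * 2) d) \<longleftrightarrow> P (mk2 a b c d)"
      using U[of "mk2 a b c d"] less.prems by (simp add: U_mat_eq_mk2)
    have "odd d"
      using less.prems by (metis dvd_diff dvd_mult odd_one)
    show ?case
    proof (cases "c = 0")
      case True
      then have "a = 1 \<and> d = 1 \<or> a = - 1 \<and> d = - 1"
        using less.prems by (simp add: zmult_eq_1_iff)
      moreover have P1: "P (mk2 1 b 0 1)" for b
        using upper_triangular_induct[of P b] one T by (simp add: mat_1_eq_mk2)
      ultimately show ?thesis
        using P1[of b] neg[OF _ P1[of "- b"]] True by auto
    next
      case False
      \<comment> \<open>As the two absolute values differ and neither is 0, moving the larger entry
        towards 0 strictly shrinks it: \<open>d\<close> by \<open>c\<close>, or \<open>c\<close> by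
        \<open>2 * d\<close>.\<close>
      have ne: "\<bar>c\<bar> \<noteq> \<bar>d\<bar>" using \<open>odd d\<close> \<open>even c\<close> by (metis dvd_abs_iff)
      have d0: "d \<noteq> 0" using \<open>odd d\<close> by auto
      consider "\<bar>c\<bar> < \<bar>d\<bar>" "\<bar>d - c\<bar> < \<bar>d\<bar>" | "\<bar>c\<bar> < \<bar>d\<bar>" "\<bar>c + d\<bar> < \<bar>d\<bar>"
        | "\<bar>c - 2 * d\<bar> < \<bar>c\<bar>" | "\<bar>c + d * 2\<bar> < \<bar>c\<bar>"
        using ne False d0 by linarith
      then show ?thesis
      proof cases
        case 1
        then show ?thesis using less.prems unfolding Tm
          by (intro less.hyps) (auto simp: algebra_simps)
      next
        case 2
        then show ?thesis using less.prems unfolding Tp[symmetric]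
          by (intro less.hyps) (auto simp: algebra_simps)
      next
        case 3
        then show ?thesis using less.prems unfolding Um
          by (intro less.hyps) (auto simp: algebra_simps)
      next
        case 4
        then show ?thesis using less.prems unfolding Up[symmetric]
          by (intro less.hyps) (auto simp: algebra_simps)
      qed
    qed
  qed
  then show ?thesis
    using assms(1) mk2_eta[of A] by (metis mk2_in_Gamma0_iff of_nat_numeral)
qed

section \<open>The multiplier of the eta quotient\<close>

text \<open>The multiplier of \<open>\<eta>(2\<tau>)/\<eta>(\<tau>)\<close> at the matrix with rows \<open>(a, b)\<close> and \<open>(2c, d)\<close> is
  \<open>exp (2 \<pi> i E / 24)\<close> with the \<open>E\<close> below, by Petersson's formula for the multiplier of \<open>\<eta>\<close>: the
  Jacobi symbols \<open>(c/d)\<close> and \<open>(2c/d)\<close> combine to \<open>(2/d)\<close>, whence the last summand.\<close>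

definition eta_exponent :: "int \<Rightarrow> int \<Rightarrow> int \<Rightarrow> int \<Rightarrow> int" where
  "eta_exponent a b c d =
    - (a + d) * c + b * d * (2 * c\<^sup>2 + 1) + 3 * c * d + 3 * ((d\<^sup>2 - 1) div 2)"

lemma dvd_24_iff: "(24 :: int) dvd x \<longleftrightarrow> 3 dvd x \<and> 8 dvd x"
proof
  assume "24 dvd x"
  then show "3 dvd x \<and> 8 dvd x" by (auto intro: dvd_trans[of _ 24])
next
  assume "3 dvd x \<and> 8 dvd x"
  then obtain k l where "x = 3 * k" "x = 8 * l" by blast
  then have "x = 24 * (3 * l - k)" by simp
  then show "24 dvd x" by simp
qed

lemma odd_square_cong_1: "odd (d :: int) \<Longrightarrow> 8 dvd d\<^sup>2 - 1"
proof -
  assume "odd d"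
  then obtain k where "d = 2 * k + 1" by (elim oddE)
  then have "d\<^sup>2 - 1 = 4 * (k * (k + 1))" by (simp add: power2_eq_square algebra_simps)
  moreover have "4 * 2 dvd 4 * (k * (k + 1))" by (intro mult_dvd_mono) auto
  ultimately show ?thesis by simp
qed

text \<open>This is right multiplication by \<open>T_mat\<close> of the matrix with rows
  \<open>(a, b)\<close> and \<open>(2 * c, d)\<close>. Once the determinant relation is used, the
  error is a polynomial that is checked modulo 3 and modulo 8.\<close>

lemma eta_exponent_T:
  assumes "a * d - 2 * b * c = 1"
  shows "[eta_exponent a (a + b) c (d + 2 * c) = eta_exponent a b c d + 1] (mod 24)"
proof -
  have "odd d" "odd a"
    using assms by (metis dvd_diff dvd_mult2 dvd_mult dvd_triv_left odd_one)+
  have "((d + 2 * c)\<^sup>2 - 1) div 2 = (d\<^sup>2 - 1) div 2 + 2 * (d * c + c * c)"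
  proof -
    have "(d + 2 * c)\<^sup>2 - 1 = (d\<^sup>2 - 1) + 2 * (2 * (d * c + c * c))"
      by (simp add: power2_eq_square algebra_simps)
    then show ?thesis by simp
  qed
  then have "eta_exponent a (a + b) c (d + 2 * c) - (eta_exponent a b c d + 1) =
      12 * c\<^sup>2 + 6 * d * c + 2 * (2 * b + a) * (c * (2 * c\<^sup>2 + 1))
        + (a * d - 2 * b * c - 1) * (2 * c\<^sup>2 + 1)"
    by (simp add: eta_exponent_def power2_eq_square algebra_simps)
  also have "\<dots> = 12 * c\<^sup>2 + 6 * d * c + 2 * (2 * b + a) * (c * (2 * c\<^sup>2 + 1))"
    using assms by simp
  finally have diff: "eta_exponent a (a + b) c (d + 2 * c) - (eta_exponent a b c d + 1) = \<dots>" .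
  \<comment> \<open>Modulo 3 only the last term matters; its factor here is 2 (c - 1) c (c + 1) + 3
    c.\<close>
  have "3 dvd c * (2 * c\<^sup>2 + 1)"
  proof -
    have "3 dvd c \<or> 3 dvd c - 1 \<or> 3 dvd c + 1" by presburger
    then have "3 dvd c * (c - 1) * (c + 1)"
      by (auto intro: dvd_mult dvd_mult2)
    then have "3 dvd 2 * (c * (c - 1) * (c + 1)) + 3 * c"
      by (intro dvd_add) simp_all
    also have "\<dots> = c * (2 * c\<^sup>2 + 1)"
      by (simp add: power2_eq_square algebra_simps)
    finally show ?thesis .
  qed
  then have "3 dvd 12 * c\<^sup>2 + 6 * d * c + 2 * (2 * b + a) * (c * (2 * c\<^sup>2 + 1))"
    by (simp add: dvd_add dvd_mult)
  moreover have "8 dvd 12 * c\<^sup>2 + 6 * d * c + 2 * (2 * b + a) * (c * (2 * c\<^sup>2 + 1))" (is "8 dvd ?Y")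
  proof (cases "even c")
    case True
    then obtain k where k: "c = 2 * k" by blast
    have "even (3 * d + a)" using \<open>odd d\<close> \<open>odd a\<close> by simp
    then obtain m where "3 * d + a = 2 * m" by blast
    then have a: "a = 2 * m - 3 * d" by simp
    have "?Y = 8 * (6 * k\<^sup>2 + 4 * (2 * b + a) * k ^ 3 + b * k + m * k)"
      by (simp add: k a power2_eq_square power3_eq_cube algebra_simps)
    then show ?thesis by simp
  next
    case False
    then obtain k where k: "c = 2 * k + 1" by (elim oddE)
    obtain i j where ij: "a = 2 * i + 1" "d = 2 * j + 1"
      using \<open>odd a\<close> \<open>odd d\<close> by (elim oddE)
    \<comment> \<open>For odd \<open>c\<close> the determinant fixes the parity of \<open>b\<close>
      as that of \<open>i + j\<close>; substituting for \<open>b\<close> accordingly exposes the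
      factor 8.\<close>
    have "b * c = 2 * (i * j) + i + j"
      using assms by (simp add: ij algebra_simps)
    then have "even b \<longleftrightarrow> even (i + j)"
      using False by (metis even_add even_mult_iff dvd_triv_left add.assoc)
    then have "even (3 * j - i - b)" by auto
    then obtain m where "3 * j - i - b = 2 * m" by blast
    then have b: "b = 3 * j - i - 2 * m" by simp
    have "?Y = 8 * (3 * (2 * k + 1) * (k + 1)
        + (2 * k + 1) * (6 * j + (6 * j - 4 * m + 1) * (2 * k\<^sup>2 + 2 * k) - 3 * m))"
      by (simp add: k ij b power2_eq_square algebra_simps)
    then show ?thesis by simp
  qed
  ultimately show ?thesis
    by (simp add: cong_iff_dvd_diff diff dvd_24_iff)
qed

text \<open>The counterpart for \<open>U_mat\<close>: the error contains
  \<open>d\<^sup>2 - 1\<close>, which is divisible by 8 as \<open>d\<close> is odd, and by 3 unless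
  3 divides \<open>d\<close>. In that case the determinant relation turns the other factor into
  \<open>(a + b) * d\<close>.\<close>

lemma eta_exponent_U:
  assumes "a * d - 2 * b * c = 1"
  shows "[eta_exponent (a + 2 * b) b (c + d) d = eta_exponent a b c d + 1] (mod 24)"
proof -
  have "odd d"
    using assms by (metis dvd_diff dvd_mult2 dvd_mult dvd_triv_left odd_one)
  have diff: "eta_exponent (a + 2 * b) b (c + d) d - (eta_exponent a b c d + 1) =
      2 * ((d\<^sup>2 - 1) * (1 + 2 * b * c + b * d))"
  proof -
    have "eta_exponent (a + 2 * b) b (c + d) d - (eta_exponent a b c d + 1) =
        2 * ((d\<^sup>2 - 1) * (1 + 2 * b * c + b * d)) - (a * d - 2 * b * c - 1)"
      by (simp add: eta_exponent_def power2_eq_square algebra_simps)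
    then show ?thesis using assms by simp
  qed
  have "3 dvd (d\<^sup>2 - 1) * (1 + 2 * b * c + b * d)"
  proof (cases "3 dvd d")
    case True
    have "1 + 2 * b * c + b * d = (a + b) * d"
      using assms by (simp add: algebra_simps)
    then show ?thesis using True by simp
  next
    case False
    then have "3 dvd d - 1 \<or> 3 dvd d + 1" by presburger
    then have "3 dvd (d - 1) * (d + 1)" by auto
    also have "\<dots> = d\<^sup>2 - 1" by (simp add: power2_eq_square algebra_simps)
    finally show ?thesis by simp
  qed
  moreover have "8 dvd (d\<^sup>2 - 1) * (1 + 2 * b * c + b * d)"
    using odd_square_cong_1[OF \<open>odd d\<close>] by simp
  ultimately show ?thesis
    by (simp add: cong_iff_dvd_diff diff dvd_24_iff)
qed

text \<open>All monomials have even degree, so the exponent descends to the projective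
  group.\<close>

lemma eta_exponent_uminus: "eta_exponent (- a) (- b) (- c) (- d) = eta_exponent a b c d"
proof -
  have "- (- a + - d) * - c = - (a + d) * c" by (simp add: distrib_right left_diff_distrib)
  then show ?thesis
    by (simp only: eta_exponent_def power2_minus minus_mult_minus mult_minus_left
        mult_minus_right minus_minus)
qed

text \<open>\<open>c\<close> is half of the lower left entry, so level 48 is what makes it divisible
  by 24.\<close>

lemma eta_exponent_Gamma_48:
  assumes "48 dvd b" "24 dvd c" "48 dvd d - 1"
  shows "24 dvd eta_exponent a b c d"
proof -
  obtain k where "d - 1 = 48 * k" using assms by blast
  then have "d = 48 * k + 1" by simp
  then have "d\<^sup>2 - 1 = 2 * (24 * (48 * k\<^sup>2 + 2 * k))"
    by (simp add: power2_eq_square algebra_simps)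
  then have "24 dvd (d\<^sup>2 - 1) div 2" by simp
  moreover have "24 dvd b" using assms(1) by (rule dvd_trans[rotated]) simp
  ultimately show ?thesis
    unfolding eta_exponent_def using assms(2) by (intro dvd_add dvd_mult dvd_mult2) auto
qed

section \<open>Lifting residues\<close>

text \<open>Add to \<open>r\<close> the product of \<open>q\<close> and all primes of
  \<open>N\<close> not dividing \<open>r\<close>. Every prime of \<open>N\<close> then divides
  exactly one of the two summands.\<close>

lemma coprime_lift:
  fixes q r N :: nat
  assumes "coprime r q" "N > 0"
  obtains v where "[v = r] (mod q)" "coprime v N"
proof
  define t where "t = \<Prod>{p \<in> prime_factors N. \<not> p dvd r}"
  show "[r + q * t = r] (mod q)"
    by (simp add: cong_def)
  show "coprime (r + q * t) N"
  proof (rule ccontr)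
    assume "\<not> coprime (r + q * t) N"
    then obtain p where p: "prime p" "p dvd r + q * t" "p dvd N"
      by (metis coprime_iff_gcd_eq_1 prime_factor_nat gcd_nat.boundedE)
    show False
    proof (cases "p dvd r")
      case True
      then have "p dvd q * t" using p(2) by (simp add: dvd_add_right_iff)
      moreover have "\<not> p dvd q"
        using True p(1) assms(1) by (metis coprime_common_divisor not_prime_unit)
      ultimately have "p dvd t" using p(1) by (simp add: prime_dvd_mult_iff)
      then obtain p' where "p' \<in> prime_factors N" "\<not> p' dvd r" "p dvd p'"
        using p(1) unfolding t_def by (subst (asm) prime_dvd_prod_iff) auto
      then show False using p(1) True by (metis in_prime_factors_imp_prime primes_dvd_imp_eq)
    next
      case False
      then have "p dvd t"
        using p assms(2) unfolding t_def by (intro dvd_prodI) (auto simp: in_prime_factors_iff)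
      then show False using False p(2) by (simp add: dvd_add_left_iff)
    qed
  qed
qed

text \<open>By lifting, every unit modulo a divisor of \<open>n\<close> squares to 1. The unit 3
  excludes the divisor 16, and the unit 2 excludes 9 and all primes above 3.\<close>

lemma dvd_24_if_dvd_squares:
  fixes n N :: nat
  assumes "n > 0" "N > 0" and sq: "\<And>v. coprime v N \<Longrightarrow> [v\<^sup>2 = 1] (mod n)"
  shows "n dvd 24"
proof -
  have lift: "[r\<^sup>2 = 1] (mod q)" if "q dvd n" "coprime r q" for q r
  proof -
    obtain v where v: "[v = r] (mod q)" "coprime v N"
      using coprime_lift \<open>coprime r q\<close> \<open>N > 0\<close> by blast
    then have "[v\<^sup>2 = 1] (mod q)"
      using sq[of v] that(1) cong_dvd_modulus_nat by blast
    then show ?thesis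
      using v(1) by (meson cong_pow cong_sym cong_trans)
  qed
  have "multiplicity p n \<le> multiplicity p 24" if "prime p" for p
  proof -
    have bound: "multiplicity p n \<le> multiplicity p 24" if "\<not> p ^ Suc k dvd n" "p ^ k dvd 24" for k
    proof -
      have "multiplicity p n < Suc k"
        using that(1) by (metis multiplicity_dvd' not_less)
      moreover have "k \<le> multiplicity p 24"
        using that(2) \<open>prime p\<close> by (intro multiplicity_geI) auto
      ultimately show ?thesis by simp
    qed
    consider "p = 2" | "p = 3" | "p \<noteq> 2" "p \<noteq> 3" by blast
    then show ?thesis
    proof cases
      case 1
      have "\<not> 16 dvd n" using lift[of 16 3] by (auto simp: cong_def coprime_iff_gcd_eq_1 gcd_nat.simps)
      then show ?thesis using bound[of 3] 1 by simp
    next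
      case 2
      have "\<not> 9 dvd n" using lift[of 9 2] by (auto simp: cong_def coprime_iff_gcd_eq_1 gcd_nat.simps)
      then show ?thesis using bound[of 1] 2 by simp
    next
      case 3
      have "\<not> p dvd n"
      proof
        assume "p dvd n"
        moreover have "coprime 2 p"
          using 3 \<open>prime p\<close> by (intro primes_coprime) auto
        ultimately have "[2\<^sup>2 = 1] (mod p)" using lift by blast
        then have "p dvd 3" by (simp add: cong_altdef_nat)
        then show False using 3 \<open>prime p\<close> by (simp add: primes_dvd_imp_eq)
      qed
      then show ?thesis using bound[of 0] by simp
    qed
  qed
  then show ?thesis using \<open>n > 0\<close> by (intro multiplicity_le_imp_dvd) auto
qed

section \<open>The kernel of an induced representation\<close>

text \<open>The right side describes the normal core of the kernel of \<open>\<psi>\<close>. If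
  \<open>x g = c x\<close> with \<open>c\<close> in that kernel, then
  \<open>f (x g) = \<psi> c * f x = f x\<close>; the converse tests \<open>g\<close> on functions
  supported on one coset.\<close>

lemma ind_rep_kernel_iff:
  assumes "group G" "subgroup H G" "one_dim_rep G H \<psi>"
  shows "g \<in> kernel G (GL (ind_space G H \<psi>)) (ind_rep G H \<psi>) \<longleftrightarrow>
    g \<in> carrier G \<and> (\<forall>x\<in>carrier G. x \<otimes>\<^bsub>G\<^esub> g \<otimes>\<^bsub>G\<^esub> inv\<^bsub>G\<^esub> x \<in> H \<and>
      \<psi> (x \<otimes>\<^bsub>G\<^esub> g \<otimes>\<^bsub>G\<^esub> inv\<^bsub>G\<^esub> x) = 1)"
    (is "?lhs \<longleftrightarrow> ?rhs")
proof
  interpret group G by fact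
  interpret H: subgroup H G by fact
  let ?V = "ind_space G H \<psi>"
  have mult: "\<psi> (x \<otimes>\<^bsub>G\<^esub> y) = \<psi> x * \<psi> y" if "x \<in> H" "y \<in> H" for x y
    using assms(3) that by (simp add: one_dim_rep_def hom_def complex_units_def)
  have nz: "\<psi> x \<noteq> 0" if "x \<in> H" for x
    using assms(3) that by (auto simp: one_dim_rep_def hom_def complex_units_def)
  show ?rhs if ?lhs
  proof (intro conjI ballI)
    show g: "g \<in> carrier G" using that by (simp add: kernel_def)
    fix x assume x: "x \<in> carrier G"
    \<comment> \<open>The element of the induced space supported on the coset \<open>H x\<close>
      with value 1 at \<open>x\<close>. If \<open>g\<close> fixes it, its value at
      \<open>x g\<close> is 1, so \<open>x g\<close> lies in \<open>H x\<close>.\<close>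
    define f where "f y = (if y \<otimes>\<^bsub>G\<^esub> inv\<^bsub>G\<^esub> x \<in> H \<and> y \<in> carrier G
      then \<psi> (y \<otimes>\<^bsub>G\<^esub> inv\<^bsub>G\<^esub> x) else 0)" for y
    have "f \<in> ?V"
    proof -
      have "f (h \<otimes>\<^bsub>G\<^esub> y) = \<psi> h * f y" if hy: "h \<in> H" "y \<in> carrier G" for h y
      proof (cases "y \<otimes>\<^bsub>G\<^esub> inv\<^bsub>G\<^esub> x \<in> H")
        case True
        then show ?thesis using hy x by (simp add: f_def m_assoc mult)
      next
        case False
        have "h \<otimes>\<^bsub>G\<^esub> (y \<otimes>\<^bsub>G\<^esub> inv\<^bsub>G\<^esub> x) \<notin> H"
        proof
          assume "h \<otimes>\<^bsub>G\<^esub> (y \<otimes>\<^bsub>G\<^esub> inv\<^bsub>G\<^esub> x) \<in> H"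
          then have "inv\<^bsub>G\<^esub> h \<otimes>\<^bsub>G\<^esub> (h \<otimes>\<^bsub>G\<^esub> (y \<otimes>\<^bsub>G\<^esub> inv\<^bsub>G\<^esub> x)) \<in> H" using hy by simp
          then show False using False hy x by (simp add: m_assoc[symmetric])
        qed
        then show ?thesis using False hy x by (simp add: f_def m_assoc)
      qed
      then show ?thesis by (auto simp: ind_space_def f_def)
    qed
    then have "ind_rep G H \<psi> g f = f"
      using that by (simp add: kernel_def GL_def BijGroup_def)
    then have "ind_rep G H \<psi> g f x = f x" by simp
    then have "f (x \<otimes>\<^bsub>G\<^esub> g) = \<psi> \<one>\<^bsub>G\<^esub>"
      using \<open>f \<in> ?V\<close> x by (simp add: ind_rep_def f_def)
    moreover have "\<psi> \<one>\<^bsub>G\<^esub> = 1"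
      using mult[of "\<one>\<^bsub>G\<^esub>" "\<one>\<^bsub>G\<^esub>"] nz[of "\<one>\<^bsub>G\<^esub>"] by simp
    ultimately show "x \<otimes>\<^bsub>G\<^esub> g \<otimes>\<^bsub>G\<^esub> inv\<^bsub>G\<^esub> x \<in> H"
      "\<psi> (x \<otimes>\<^bsub>G\<^esub> g \<otimes>\<^bsub>G\<^esub> inv\<^bsub>G\<^esub> x) = 1"
      by (auto simp: f_def split: if_splits)
  qed
  show ?lhs if rhs: ?rhs
  proof -
    have "f (x \<otimes>\<^bsub>G\<^esub> g) = f x" if "f \<in> ?V" "x \<in> carrier G" for f x
    proof -
      let ?c = "x \<otimes>\<^bsub>G\<^esub> g \<otimes>\<^bsub>G\<^esub> inv\<^bsub>G\<^esub> x"
      have "f (?c \<otimes>\<^bsub>G\<^esub> x) = \<psi> ?c * f x"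
        using rhs that by (simp add: ind_space_def)
      moreover have "?c \<otimes>\<^bsub>G\<^esub> x = x \<otimes>\<^bsub>G\<^esub> g"
        using rhs that by (simp add: m_assoc)
      ultimately show ?thesis using rhs that by simp
    qed
    then have "ind_rep G H \<psi> g f = f" if "f \<in> ?V" for f
      using that by (auto simp: ind_rep_def ind_space_def fun_eq_iff)
    then have "ind_rep G H \<psi> g = (\<lambda>f\<in>?V. f)"
      by (auto simp: fun_eq_iff ind_rep_def)
    then show ?thesis
      using rhs by (simp add: kernel_def GL_def BijGroup_def)
  qed
qed

text \<open>\<open>GL\<close> shares its product and unit with \<open>BijGroup\<close>, so the
  kernel is also that of a homomorphism into the known group \<open>BijGroup\<close>.\<close>

lemma subgroup_ind_rep_kernel:
  assumes "group G" "subgroup H G"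
  shows "subgroup (kernel G (GL (ind_space G H \<psi>)) (ind_rep G H \<psi>)) G"
proof -
  let ?V = "ind_space G H \<psi>"
  have "ind_rep G H \<psi> \<in> hom G (BijGroup ?V)"
    using ind_rep_hom[OF assms, of \<psi>] by (auto simp: hom_def GL_def BijGroup_def)
  then have "group_hom G (BijGroup ?V) (ind_rep G H \<psi>)"
    using assms(1) by (simp add: group_hom_def group_hom_axioms_def group_BijGroup)
  moreover have "kernel G (GL ?V) (ind_rep G H \<psi>) = kernel G (BijGroup ?V) (ind_rep G H \<psi>)"
    by (simp add: kernel_def GL_def)
  ultimately show ?thesis
    using group_hom.subgroup_kernel by metis
qed

section \<open>Characters of \<open>\<Gamma>\<^sub>0(2)\<close>\<close>

lemma powi_cong:
  fixes z :: "'a :: field"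
  assumes "z ^ m = 1" "m > 0" "[x = y] (mod int m)"
  shows "z powi x = z powi y"
proof -
  obtain k where "x = y + int m * k"
    using assms(3) by (metis cong_iff_lin cong_sym)
  moreover have "z \<noteq> 0" using assms(1,2) by (auto simp: power_0_left)
  ultimately show ?thesis
    using assms(1) by (simp add: power_int_add power_int_mult)
qed

lemma Gamma0_char_mult:
  assumes "one_dim_rep PSL2Z (PGamma0 N) \<psi>" "A \<in> Gamma0 N" "B \<in> Gamma0 N"
  shows "\<psi> (pbar (A ** B)) = \<psi> (pbar A) * \<psi> (pbar B)"
proof -
  have "pbar (A ** B) = pbar A \<otimes>\<^bsub>PSL2Z\<^esub> pbar B"
    using assms(2,3) pbar.hom_mult[of A B] by (simp add: Gamma0_def)
  moreover have "pbar A \<in> PGamma0 N" "pbar B \<in> PGamma0 N"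
    using assms(2,3) by (simp_all add: PGamma0_def)
  ultimately show ?thesis
    using assms(1) by (simp add: one_dim_rep_def hom_def complex_units_def)
qed

lemma Gamma0_char_nonzero:
  assumes "one_dim_rep PSL2Z (PGamma0 N) \<psi>" "A \<in> Gamma0 N"
  shows "\<psi> (pbar A) \<noteq> 0"
proof -
  have "pbar A \<in> PGamma0 N"
    using assms(2) by (simp add: PGamma0_def)
  then show ?thesis
    using assms(1) by (auto simp: one_dim_rep_def hom_def complex_units_def)
qed

lemma Gamma0_char_one:
  assumes "one_dim_rep PSL2Z (PGamma0 N) \<psi>"
  shows "\<psi> (pbar (mat 1)) = 1"
proof -
  have "(mat 1 :: mat2) \<in> Gamma0 N" by (simp add: mat_1_eq_mk2)
  then show ?thesis
    using Gamma0_char_mult[OF assms, of "mat 1" "mat 1"] Gamma0_char_nonzero[OF assms, of "mat 1"]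
    by simp
qed

lemma Gamma0_char_U_power:
  assumes "one_dim_rep PSL2Z (PGamma0 2) \<psi>"
  shows "\<psi> (pbar (mk2 1 0 (2 * int k) 1)) = \<psi> (pbar U_mat) ^ k"
proof (induction k)
  case 0
  then show ?case using Gamma0_char_one[OF assms] by (simp add: mat_1_eq_mk2)
next
  case (Suc k)
  have "mk2 1 0 (2 * int (Suc k)) 1 = U_mat ** mk2 1 0 (2 * int k) 1"
    by (simp add: U_mat_eq_mk2)
  then show ?case
    using Suc Gamma0_char_mult[OF assms U_mat_in_Gamma0, of "mk2 1 0 (2 * int k) 1"] by simp
qed

text \<open>Both sides ignore the sign of \<open>A\<close> and gain the same factor under right
  multiplication by \<open>T_mat\<close> or \<open>U_mat\<close>, so \<open>Gamma0_2_induct\<close>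
  applies. The values at \<open>T_mat\<close> and \<open>U_mat\<close> differ by the sign
  \<open>\<epsilon>\<close>, which the parity of the upper right entry records.\<close>

lemma Gamma0_2_char_formula:
  assumes rep: "one_dim_rep PSL2Z (PGamma0 2) \<psi>" and z24: "\<psi> (pbar U_mat) ^ 24 = 1"
  obtains \<epsilon> where "\<epsilon>\<^sup>2 = 1"
    "\<And>A. A \<in> Gamma0 2 \<Longrightarrow> \<psi> (pbar A) = \<epsilon> powi (A $ 1 $ 2) *
      \<psi> (pbar U_mat) powi eta_exponent (A $ 1 $ 1) (A $ 1 $ 2) (A $ 2 $ 1 div 2) (A $ 2 $ 2)"
proof
  let ?\<chi> = "\<lambda>A. \<psi> (pbar A)"
  let ?\<zeta> = "?\<chi> U_mat"
  text \<open>\<open>T = W U\<close>, where \<open>W\<close> is elliptic of order two in the projective group.\<close>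
  define W where "W = mk2 (- 1) 1 (- 2) 1"
  let ?\<epsilon> = "?\<chi> W"
  have W: "W \<in> Gamma0 2" by (simp add: W_def)
  have "W ** W = - mat 1" by (simp add: W_def mat_1_eq_mk2)
  then show eps: "?\<epsilon>\<^sup>2 = 1"
    using Gamma0_char_mult[OF rep W W] Gamma0_char_one[OF rep]
    by (simp add: pbar_uminus power2_eq_square)
  have "T_mat = W ** U_mat" by (simp add: W_def T_mat_def U_mat_eq_mk2)
  then have T: "?\<chi> T_mat = ?\<epsilon> * ?\<zeta>"
    using Gamma0_char_mult[OF rep W U_mat_in_Gamma0] by simp
  have nz: "?\<epsilon> \<noteq> 0" "?\<zeta> \<noteq> 0"
    using Gamma0_char_nonzero[OF rep] W U_mat_in_Gamma0 by auto
  define R where "R A = ?\<epsilon> powi (A $ 1 $ 2) *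
    ?\<zeta> powi eta_exponent (A $ 1 $ 1) (A $ 1 $ 2) (A $ 2 $ 1 div 2) (A $ 2 $ 2)" for A :: mat2
  have eps_cong: "?\<epsilon> powi x = ?\<epsilon> powi y" if "[x = y] (mod 2)" for x y
    using powi_cong[of ?\<epsilon> 2] eps that by simp
  have zeta_cong: "?\<zeta> powi x = ?\<zeta> powi y" if "[x = y] (mod 24)" for x y
    using powi_cong[of ?\<zeta> 24] z24 that by simp
  show "?\<chi> A = ?\<epsilon> powi (A $ 1 $ 2) *
      ?\<zeta> powi eta_exponent (A $ 1 $ 1) (A $ 1 $ 2) (A $ 2 $ 1 div 2) (A $ 2 $ 2)"
    if "A \<in> Gamma0 2" for A
    using that unfolding R_def[symmetric]
  proof (induction A rule: Gamma0_2_induct)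
    case one
    then show ?case
      using Gamma0_char_one[OF rep] by (simp add: mat_1_eq_mk2 R_def eta_exponent_def)
  next
    case (neg A)
    then obtain a b c d where A: "A = mk2 a b (2 * c) d"
      by (metis mk2_eta mk2_in_Gamma0_iff of_nat_numeral dvdE)
    have "?\<epsilon> powi (- b) = ?\<epsilon> powi b"
      by (rule eps_cong) (simp add: cong_iff_dvd_diff)
    then have "R (- A) = R A"
      by (simp add: A R_def eta_exponent_uminus flip: mult_minus_right)
    then show ?case using neg by (simp add: pbar_uminus)
  next
    case (T A)
    then obtain a b c d where A: "A = mk2 a b (2 * c) d"
      by (metis mk2_eta mk2_in_Gamma0_iff of_nat_numeral dvdE)
    have det: "a * d - 2 * b * c = 1" using T by (simp add: A)
    \<comment> \<open>Oddness of \<open>a\<close> makes \<open>T_mat\<close> flip the parity of the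
      upper right entry.\<close>
    then have "odd a"
      by (metis dvd_diff dvd_mult2 dvd_mult dvd_triv_left odd_one)
    then have "?\<epsilon> powi (a + b) = ?\<epsilon> powi (b + 1)"
      by (intro eps_cong) (simp add: cong_iff_dvd_diff)
    moreover have "?\<zeta> powi eta_exponent a (a + b) c (d + 2 * c) = ?\<zeta> powi (eta_exponent a b c d + 1)"
      by (rule zeta_cong[OF eta_exponent_T[OF det]])
    ultimately have "R (A ** T_mat) = R A * (?\<epsilon> * ?\<zeta>)"
      using nz by (simp add: A T_mat_def R_def power_int_add add.commute)
    moreover have "?\<chi> (A ** T_mat) = ?\<chi> A * (?\<epsilon> * ?\<zeta>)"
      using Gamma0_char_mult[OF rep T T_mat_in_Gamma0] \<open>?\<chi> T_mat = _\<close> by simp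
    ultimately show ?case using nz by simp
  next
    case (U A)
    then obtain a b c d where A: "A = mk2 a b (2 * c) d"
      by (metis mk2_eta mk2_in_Gamma0_iff of_nat_numeral dvdE)
    have det: "a * d - 2 * b * c = 1" using U by (simp add: A)
    have "(2 * c + d * 2) div 2 = c + d" by simp
    moreover have "?\<zeta> powi eta_exponent (a + 2 * b) b (c + d) d = ?\<zeta> powi (eta_exponent a b c d + 1)"
      by (rule zeta_cong[OF eta_exponent_U[OF det]])
    ultimately have "R (A ** U_mat) = R A * ?\<zeta>"
      using nz by (simp add: A U_mat_eq_mk2 R_def power_int_add mult.commute)
    moreover have "?\<chi> (A ** U_mat) = ?\<chi> A * ?\<zeta>"
      using Gamma0_char_mult[OF rep U U_mat_in_Gamma0] by simp
    ultimately show ?case using nz by simp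
  qed
qed

lemma Gamma0_2_char_trivial_on_Gamma_48:
  assumes "one_dim_rep PSL2Z (PGamma0 2) \<psi>" "\<psi> (pbar U_mat) ^ 24 = 1" "A \<in> Gamma_princ 48"
  shows "\<psi> (pbar A) = 1"
proof -
  obtain \<epsilon> where eps: "\<epsilon>\<^sup>2 = 1"
    and formula: "\<And>A. A \<in> Gamma0 2 \<Longrightarrow> \<psi> (pbar A) = \<epsilon> powi (A $ 1 $ 2) *
      \<psi> (pbar U_mat) powi eta_exponent (A $ 1 $ 1) (A $ 1 $ 2) (A $ 2 $ 1 div 2) (A $ 2 $ 2)"
    using Gamma0_2_char_formula[OF assms(1,2)] by metis
  obtain a b c d where A: "A = mk2 a b c d" by (metis mk2_eta)
  have div: "48 dvd b" "48 dvd c" "48 dvd d - 1"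
    using assms(3) by (simp_all add: A)
  have "\<epsilon> powi b = \<epsilon> powi 0"
    by (rule powi_cong[OF eps]) (use div(1) in \<open>auto simp: cong_0_iff\<close>)
  moreover have "24 dvd c div 2" using div(2) by presburger
  then have "24 dvd eta_exponent a b (c div 2) d"
    using div by (intro eta_exponent_Gamma_48)
  then have "\<psi> (pbar U_mat) powi eta_exponent a b (c div 2) d = \<psi> (pbar U_mat) powi 0"
    by (intro powi_cong[OF assms(2)]) (auto simp: cong_0_iff)
  moreover have "A \<in> Gamma0 2"
    using Gamma_princ_subset_Gamma0[of 2 48] assms(3) by auto
  ultimately show ?thesis
    using formula[of A] by (simp add: A)
qed

lemma char_U_power_square:
  assumes rep: "one_dim_rep PSL2Z (PGamma0 2) \<psi>" and "even N"
    and trivial: "\<And>A. A \<in> Gamma_princ N \<Longrightarrow> \<psi> (pbar A) = 1"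
    and "coprime v N"
  shows "\<psi> (pbar U_mat) ^ v\<^sup>2 = \<psi> (pbar U_mat)"
proof -
  let ?\<chi> = "\<lambda>A. \<psi> (pbar A)"
  \<comment> \<open>Inverting modulo the square of \<open>N\<close> lets \<open>u * v - 1\<close>
    split as \<open>(N * t) * N\<close>, so both off-diagonal entries of \<open>A\<close> are
    multiples of \<open>N\<close>.\<close>
  have "coprime (int v) ((int N)\<^sup>2)" using \<open>coprime v N\<close> by simp
  then obtain u where "[int v * u = 1] (mod (int N)\<^sup>2)"
    using coprime_iff_invertible_int by blast
  then have "(int N)\<^sup>2 dvd u * int v - 1"
    by (simp add: cong_iff_dvd_diff mult.commute)
  then obtain t where t: "u * int v - 1 = (int N)\<^sup>2 * t" by blast
  text \<open>\<open>A \<equiv> diag(u, v)\<close> modulo \<open>N\<close>, and \<open>C = A U A\<^sup>-\<^sup>1 L\<^sup>-\<^sup>1\<close>.\<close>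
  define A where "A = mk2 u (int N * t) (int N) (int v)"
  define L where "L = mk2 1 0 (2 * int (v\<^sup>2)) 1"
  define C where "C = mk2 (1 + 2 * int N * t * int v + 4 * (int N)\<^sup>2 * t\<^sup>2 * (int v)\<^sup>2)
    (- 2 * (int N)\<^sup>2 * t\<^sup>2) (4 * int N * t * (int v) ^ 3) (1 - 2 * int N * t * int v)"
  have "int N * t * int N = u * int v - 1" using t by (simp add: power2_eq_square algebra_simps)
  then have A: "A \<in> Gamma0 2"
    using \<open>even N\<close> by (simp add: A_def)
  have L: "L \<in> Gamma0 2" by (simp add: L_def)
  have C: "C \<in> Gamma_princ N"
    by (auto simp: C_def power2_eq_square power3_eq_cube algebra_simps)
  then have C0: "C \<in> Gamma0 2"
    using Gamma_princ_subset_Gamma0[of 2 N] \<open>even N\<close> by auto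
  have LA: "L ** A \<in> Gamma0 2"
    using subgroup.m_closed[OF subgroup_Gamma0 L A] by simp
  \<comment> \<open>This product is A U A^-1 written out: with column (N t, v) and row (v, -N t), it
    is 1 plus twice their product.\<close>
  have "C ** L = mk2 (1 + 2 * int N * t * int v) (- 2 * (int N)\<^sup>2 * t\<^sup>2)
      (2 * (int v)\<^sup>2) (1 - 2 * int N * t * int v)"
    by (simp add: C_def L_def power2_eq_square power3_eq_cube algebra_simps)
  \<comment> \<open>Here \<open>u * v - N\<^sup>2 * t\<close>, the determinant of \<open>A\<close>,
    is replaced by 1.\<close>
  moreover have "u + 2 * int N * t * (u * int v - (int N)\<^sup>2 * t) = u + int N * t * 2"
    "int N + 2 * int v * (u * int v - (int N)\<^sup>2 * t) = int N + int v * 2"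
    using t by (simp_all add: diff_eq_eq)
  ultimately have "A ** U_mat = (C ** L) ** A"
    by (simp add: A_def U_mat_eq_mk2 power2_eq_square algebra_simps)
  then have "A ** U_mat = C ** (L ** A)"
    by (simp add: matrix_mul_assoc)
  then have "?\<chi> A * ?\<chi> U_mat = ?\<chi> C * (?\<chi> L * ?\<chi> A)"
    using Gamma0_char_mult[OF rep] A U_mat_in_Gamma0 C0 L LA by metis
  also have "\<dots> = ?\<chi> U_mat ^ v\<^sup>2 * ?\<chi> A"
    using trivial[OF C] Gamma0_char_U_power[OF rep, of "v\<^sup>2"] by (simp add: L_def)
  finally show ?thesis
    using Gamma0_char_nonzero[OF rep A] by simp
qed

theorem theorem2p5:
  fixes \<psi> :: "mat2 set \<Rightarrow> complex" and n :: nat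
  assumes "one_dim_rep PSL2Z (PGamma0 2) \<psi>"
    and "finite (\<psi> ` PGamma0 2)"
    and "primitive_root_of_unity n (\<psi> (pbar U_mat))"
  shows "congruence_subgroup
      (kernel PSL2Z (GL (ind_space PSL2Z (PGamma0 2) \<psi>)) (ind_rep PSL2Z (PGamma0 2) \<psi>))
    \<longleftrightarrow> n dvd 24"
proof -
  let ?K = "kernel PSL2Z (GL (ind_space PSL2Z (PGamma0 2) \<psi>)) (ind_rep PSL2Z (PGamma0 2) \<psi>)"
  let ?\<zeta> = "\<psi> (pbar U_mat)"
  note K_iff = ind_rep_kernel_iff[OF group_PSL2Z subgroup_PGamma0 assms(1)]
  have n: "n > 0" "?\<zeta> ^ n = 1" and min: "\<And>k. 1 \<le> k \<Longrightarrow> k < n \<Longrightarrow> ?\<zeta> ^ k \<noteq> 1"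
    using assms(3) by (auto simp: primitive_root_of_unity_def)
  have order: "n dvd k" if "?\<zeta> ^ k = 1" for k
  proof -
    have "?\<zeta> ^ k = ?\<zeta> ^ (n * (k div n) + k mod n)" by simp
    also have "\<dots> = ?\<zeta> ^ (k mod n)" by (simp only: power_add power_mult n power_one mult_1)
    finally have "k mod n = 0"
      using that min[of "k mod n"] n(1) by (metis One_nat_def Suc_leI mod_less_divisor neq0_conv)
    then show ?thesis by (simp add: dvd_eq_mod_eq_0)
  qed
  show ?thesis
  proof
    assume "congruence_subgroup ?K"
    then obtain N where N: "N \<ge> 1" "pbar ` Gamma_princ N \<subseteq> ?K"
      by (auto simp: congruence_subgroup_def)
    \<comment> \<open>Doubling the level makes it even, which keeps the matrices inside
      \<open>Gamma0 2\<close>. The kernel criterion is used at the identity.\<close>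
    have trivial: "\<psi> (pbar A) = 1" if "A \<in> Gamma_princ (2 * N)" for A
    proof -
      have "pbar A \<in> ?K"
        using N(2) that Gamma_princ_mono[of N "2 * N"] by auto
      then show ?thesis
        using K_iff[of "pbar A"] PSL2.one_closed by (metis PSL2.inv_one PSL2.l_one PSL2.r_one)
    qed
    show "n dvd 24"
    proof (rule dvd_24_if_dvd_squares[of n "2 * n * N"])
      fix v assume "coprime v (2 * n * N)"
      then have "coprime v (2 * N)" "v > 0"
        by (auto intro: gr0I)
      then have "?\<zeta> ^ v\<^sup>2 = ?\<zeta>"
        by (intro char_U_power_square[OF assms(1) _ trivial]) auto
      \<comment> \<open>As \<open>v > 0\<close>, the subtraction of naturals is not truncated, and
        one factor can be cancelled.\<close>
      moreover have "?\<zeta> ^ v\<^sup>2 = ?\<zeta> * ?\<zeta> ^ (v\<^sup>2 - 1)"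
        using \<open>v > 0\<close> by (simp flip: power_Suc)
      moreover have "?\<zeta> \<noteq> 0" using n by (auto simp: power_0_left)
      ultimately have "n dvd v\<^sup>2 - 1" by (intro order) simp
      then show "[v\<^sup>2 = 1] (mod n)"
        using \<open>v > 0\<close> by (simp add: cong_altdef_nat)
    qed (use n N in auto)
  next
    assume "n dvd 24"
    then obtain k where "24 = n * k" by blast
    then have z24: "?\<zeta> ^ 24 = 1"
      using n(2) by (simp only: power_mult power_one)
    have "pbar A \<in> ?K" if A: "A \<in> Gamma_princ 48" for A
    proof -
      \<comment> \<open>The kernel criterion asks about all conjugates; they lift to conjugates in
        \<open>SL2Z\<close>, which stay in \<open>Gamma_princ 48\<close>.\<close>
      have "pbar X \<otimes>\<^bsub>PSL2Z\<^esub> pbar A \<otimes>\<^bsub>PSL2Z\<^esub> inv\<^bsub>PSL2Z\<^esub> pbar X \<in> PGamma0 2 \<and>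
          \<psi> (pbar X \<otimes>\<^bsub>PSL2Z\<^esub> pbar A \<otimes>\<^bsub>PSL2Z\<^esub> inv\<^bsub>PSL2Z\<^esub> pbar X) = 1" if X: "det X = 1" for X
      proof -
        have dA: "det A = 1" using A by (simp add: Gamma_princ_def)
        let ?B = "X ** A ** inv\<^bsub>SL2Z\<^esub> X"
        have B: "?B \<in> Gamma_princ 48" by (rule Gamma_princ_conj[OF A X])
        have "pbar ?B = pbar X \<otimes>\<^bsub>PSL2Z\<^esub> pbar A \<otimes>\<^bsub>PSL2Z\<^esub> inv\<^bsub>PSL2Z\<^esub> pbar X"
        proof -
          have "pbar ?B = pbar (X ** A) \<otimes>\<^bsub>PSL2Z\<^esub> pbar (inv\<^bsub>SL2Z\<^esub> X)"
            using X dA SL2.inv_closed[of X] pbar.hom_mult[of "X ** A" "inv\<^bsub>SL2Z\<^esub> X"]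
            by (simp add: det_mul)
          also have "pbar (X ** A) = pbar X \<otimes>\<^bsub>PSL2Z\<^esub> pbar A"
            using X dA pbar.hom_mult[of X A] by simp
          also have "pbar (inv\<^bsub>SL2Z\<^esub> X) = inv\<^bsub>PSL2Z\<^esub> pbar X"
            using X by (intro pbar.hom_inv) simp
          finally show ?thesis .
        qed
        moreover have "pbar ?B \<in> PGamma0 2"
          using B Gamma_princ_subset_Gamma0[of 2 48] by (auto simp: PGamma0_def)
        moreover have "\<psi> (pbar ?B) = 1"
          by (rule Gamma0_2_char_trivial_on_Gamma_48[OF assms(1) z24 B])
        ultimately show ?thesis by simp
      qed
      moreover have "pbar A \<in> carrier PSL2Z"
        using A pbar.hom_closed[of A] by (simp add: Gamma_princ_def)
      ultimately show ?thesis
        unfolding K_iff using pbar_surj by blast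
    qed
    then have "pbar ` Gamma_princ 48 \<subseteq> ?K" by blast
    moreover have "subgroup ?K PSL2Z"
      by (rule subgroup_ind_rep_kernel[OF group_PSL2Z subgroup_PGamma0])
    ultimately show "congruence_subgroup ?K"
      unfolding congruence_subgroup_def by (intro conjI exI[of _ 48]) auto
  qed
qed

end
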